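(* Let $\mathbb{Z}$ be a finite dimensional real inner product space with induced norm $\|\cdot\|$, let $\mathcal{F}:\mathbb{Z}\rightrightarrows\mathbb{Z}$ be a maximally monotone operator with $\mathcal{F}^{-1}(0)\neq\emptyset$, and let $\gamma>0$. Let $\{\lambda_k\}_{k\ge 0}\subseteq[0,2]$ satisfy $\sum_{k=0}^{\infty}\lambda_k(2-\lambda_k)=+\infty$, and let $\{z^k\}$ be generated from an arbitrary $z^0\in\mathbb{Z}$ by the generalized proximal point algorithm $$z^{k+1}=z^k+\lambda_k\big(\mathcal{J}_{\gamma\mathcal{F}}z^k-z^k\big),\qquad k\in\mathbb{N}.$$ Then the following hold. (a) The sequence $\{z^k\}$ converges to a point $z^*\in\mathcal{F}^{-1}(0)$, and moreover $$\|z^{k+1}-z\|^2\le\|z^k-z\|^2-\lambda_k(2-\lambda_k)\|\mathcal{J}_{\gamma\mathcal{F}}z^k-z^k\|^2\qquad\forall z\in\mathcal{F}^{-1}(0),\ \forall k\in\mathbb{N}.$$ (b) If in addition $\mathcal{F}$ is metrically subregular at $(z^*,0)\in{\rm gph}\,\mathcal{F}$ with constant $\kappa>0$, then there exists $\overline{k}\in\mathbb{N}$ such that $${\rm dist}\big(z^{k+1},\mathcal{F}^{-1}(0)\big)\le\sqrt{1-\frac{\lambda_k(2-\lambda_k)\gamma^2}{(\gamma+\kappa)^2}}\;{\rm dist}\big(z^k,\mathcal{F}^{-1}(0)\big)\qquad\text{for all }k\ge\overline{k}.$$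
   Context: For an operator $\mathcal{T}:\mathbb{Z}\rightrightarrows\mathbb{Z}$ (set-valued map) and $\gamma>0$, $\mathcal{J}_{\gamma\mathcal{T}}=(\mathcal{I}+\gamma\mathcal{T})^{-1}$ denotes its resolvent of index $\gamma$, where $\mathcal{I}$ is the identity. ${\rm gph}\,\mathcal{T}=\{(x,y): y\in\mathcal{T}(x)\}$, $\mathcal{T}^{-1}(y)=\{x: y\in\mathcal{T}(x)\}$, and ${\rm dist}(x,S)=\inf_{s\in S}\|x-s\|$ (equal to $+\infty$ if $S=\emptyset$). An operator $\mathcal{T}$ is metrically subregular at $(\overline{x},\overline{y})\in{\rm gph}\,\mathcal{T}$ with constant $\kappa>0$ if there is a neighborhood $U$ of $\overline{x}$ such that ${\rm dist}(x,\mathcal{T}^{-1}(\overline{y}))\le\kappa\,{\rm dist}(\overline{y},\mathcal{T}x)$ for all $x\in U$. *)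

theory Defs
  imports "HOL-Analysis.Analysis"
begin

definition gph :: "('a \<Rightarrow> 'b set) \<Rightarrow> ('a \<times> 'b) set" where
  "gph T = {(x, y). y \<in> T x}"

definition op_inverse :: "('a \<Rightarrow> 'b set) \<Rightarrow> 'b \<Rightarrow> 'a set" where
  "op_inverse T y = {x. y \<in> T x}"

definition monotone_operator :: "('a::real_inner \<Rightarrow> 'a set) \<Rightarrow> bool" where
  "monotone_operator T \<longleftrightarrow>
     (\<forall>x u y v. (x, u) \<in> gph T \<longrightarrow> (y, v) \<in> gph T \<longrightarrow> 0 \<le> (x - y) \<bullet> (u - v))"

definition maximally_monotone :: "('a::real_inner \<Rightarrow> 'a set) \<Rightarrow> bool" where
  "maximally_monotone T \<longleftrightarrow>
     monotone_operator T \<and> (\<forall>S. monotone_operator S \<longrightarrow> gph T \<subseteq> gph S \<longrightarrow> gph S = gph T)"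

definition resolvent :: "real \<Rightarrow> ('a::real_vector \<Rightarrow> 'a set) \<Rightarrow> 'a \<Rightarrow> 'a set" where
  "resolvent \<gamma> T = op_inverse (\<lambda>x. {x + \<gamma> *\<^sub>R u | u. u \<in> T x})"

text \<open>
  The resolvent of a maximally monotone operator has exactly one value at every point
  (Minty). This is the corresponding point-valued map; it is unspecified at points where the
  set-valued resolvent is not a singleton.
\<close>

definition resolvent_map :: "real \<Rightarrow> ('a::real_vector \<Rightarrow> 'a set) \<Rightarrow> 'a \<Rightarrow> 'a" where
  "resolvent_map \<gamma> T x = the_elem (resolvent \<gamma> T x)"

text \<open>
  Extended-real valued, so that the distance to the empty set is \<open>\<infinity>\<close>; the library's
  \<^const>\<open>infdist\<close> is \<open>0\<close> there.
\<close>

definition dist_set :: "'a::real_normed_vector \<Rightarrow> 'a set \<Rightarrow> ereal" where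
  "dist_set x S = (INF s\<in>S. ereal (norm (x - s)))"

definition metrically_subregular ::
  "('a::real_normed_vector \<Rightarrow> 'b::real_normed_vector set) \<Rightarrow> 'a \<Rightarrow> 'b \<Rightarrow> real \<Rightarrow> bool" where
  "metrically_subregular T xb yb \<kappa> \<longleftrightarrow>
     (xb, yb) \<in> gph T \<and> \<kappa> > 0 \<and>
     (\<exists>U. open U \<and> xb \<in> U \<and>
        (\<forall>x\<in>U. dist_set x (op_inverse T yb) \<le> ereal \<kappa> * dist_set yb (T x)))"

end

theory Submission
  imports Defs
begin

text \<open>
  Write \<open>J\<close> for the resolvent of index \<open>\<gamma>\<close> and \<open>S\<close> for the set of zeros of \<open>F\<close>. By Minty's
  theorem \<open>J\<close> is defined everywhere; by monotonicity it is single-valued and firmly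
  nonexpansive, and its fixed points are exactly the points of \<open>S\<close>. Expanding the square of
  \<open>norm (z (Suc k) - w)\<close> for \<open>w \<in> S\<close> then gives the inequality of part (a)
  (\<open>relaxed_resolvent_step\<close>).

  Convergence: summing that inequality bounds the series of
  \<open>lam k * (2 - lam k) * (norm (J (z k) - z k))\<^sup>2\<close>, so, the weights having infinite sum, the
  residuals \<open>norm (J (z k) - z k)\<close> have infimum 0. Compactness of balls yields a cluster
  point along which the residuals vanish; it is a fixed point of \<open>J\<close>, hence a zero, and since
  the distance of \<open>z k\<close> to any given zero never increases, the whole sequence converges to it.

  Rate: for large \<open>k\<close> the point \<open>J (z k)\<close> is in the neighbourhood given by subregularity, and
  \<open>(z k - J (z k)) / \<gamma>\<close> belongs to \<open>F (J (z k))\<close>, so the distance from \<open>z k\<close> to \<open>S\<close> is at most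
  \<open>(1 + \<kappa> / \<gamma>) * norm (J (z k) - z k)\<close>. Inserting this lower bound on the residual in the
  inequality of part (a), and taking the infimum over \<open>w \<in> S\<close>, gives the claim.

  Minty's theorem asks for a common point of a family of closed balls, one for each element of
  the graph. By compactness, finitely many may be considered at a time
  (\<open>monotone_common_point\<close>), and for those the point comes from minimising a convex quadratic
  function over a polytope (\<open>finite_monotone_common_point\<close>).
\<close>

section \<open>Compactness of closed balls in finite dimension\<close>

text \<open>
  The vectors of \<open>C\<close> need not be nonzero: the coefficient of \<open>0\<close> is \<open>0 / 0 = 0\<close>.
\<close>

lemma orthogonal_spanning_expansion:
  fixes C :: "'a::real_inner set"
  assumes fin: "finite C" and orth: "pairwise orthogonal C" and x: "x \<in> span C"
  shows "x = (\<Sum>c\<in>C. (x \<bullet> c / (c \<bullet> c)) *\<^sub>R c)"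
proof -
  define y where "y = x - (\<Sum>c\<in>C. (x \<bullet> c / (c \<bullet> c)) *\<^sub>R c)"
  have "orthogonal y d" if d: "d \<in> C" for d
  proof -
    have "(\<Sum>c\<in>C. (x \<bullet> c / (c \<bullet> c)) * (c \<bullet> d)) = (\<Sum>c\<in>C. if c = d then x \<bullet> d else 0)"
    proof (rule sum.cong [OF refl])
      fix c assume "c \<in> C"
      then show "(x \<bullet> c / (c \<bullet> c)) * (c \<bullet> d) = (if c = d then x \<bullet> d else 0)"
        using orth d unfolding pairwise_def orthogonal_def by (cases "d = 0") auto
    qed
    also have "\<dots> = x \<bullet> d"
      using fin d by simp
    finally show ?thesis
      by (simp add: y_def orthogonal_def inner_diff_left inner_sum_left)
  qed
  moreover have "y \<in> span C"
    unfolding y_def by (intro span_diff x span_sum span_scale span_base)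
  ultimately have "orthogonal y y"
    using orthogonal_to_span by blast
  then show ?thesis
    by (simp add: orthogonal_def y_def)
qed

lemma compact_superset_of_bounded_combinations:
  fixes C :: "'a::real_normed_vector set" and M :: "'a \<Rightarrow> real"
  assumes "finite C"
  shows "\<exists>K. compact K \<and> (\<forall>a. (\<forall>c\<in>C. \<bar>a c\<bar> \<le> M c) \<longrightarrow> (\<Sum>c\<in>C. a c *\<^sub>R c) \<in> K)"
  using assms
proof (induction C rule: finite_induct)
  case empty
  show ?case by (intro exI [of _ "{0}"]) simp
next
  case (insert d C)
  then obtain K where K: "compact K"
    and mem: "\<And>a. \<forall>c\<in>C. \<bar>a c\<bar> \<le> M c \<Longrightarrow> (\<Sum>c\<in>C. a c *\<^sub>R c) \<in> K"
    by blast
  define L where "L = {x + y |x y. x \<in> (\<lambda>t. t *\<^sub>R d) ` {- M d..M d} \<and> y \<in> K}"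
  have "compact L"
    unfolding L_def by (intro compact_sums K compact_continuous_image continuous_intros compact_Icc)
  moreover have "(\<Sum>c\<in>insert d C. a c *\<^sub>R c) \<in> L" if "\<forall>c\<in>insert d C. \<bar>a c\<bar> \<le> M c" for a
  proof -
    have "a d *\<^sub>R d \<in> (\<lambda>t. t *\<^sub>R d) ` {- M d..M d}"
      using that by (intro imageI) (simp add: abs_le_iff)
    moreover have "(\<Sum>c\<in>C. a c *\<^sub>R c) \<in> K"
      using that by (intro mem) simp
    ultimately show ?thesis
      unfolding L_def using insert.hyps by auto
  qed
  ultimately show ?case by blast
qed

text \<open>
  Finite dimension is a hypothesis on a real inner product space here, not a type class. The
  coordinates of the points of a ball with respect to a finite orthogonal spanning set are
  bounded, so the ball is a closed subset of a compact set.
\<close>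

lemma compact_cball_if_finite_span:
  fixes x :: "'a::real_inner"
  assumes "\<exists>B :: 'a set. finite B \<and> span B = UNIV"
  shows "compact (cball x r)"
proof -
  obtain C :: "'a set" where C: "finite C" "span C = UNIV" "pairwise orthogonal C"
    using assms basis_orthogonal by metis
  define M where "M c = (norm x + r) / norm c" for c :: 'a
  obtain K where K: "compact K"
    and mem: "\<And>a. \<forall>c\<in>C. \<bar>a c\<bar> \<le> M c \<Longrightarrow> (\<Sum>c\<in>C. a c *\<^sub>R c) \<in> K"
    using compact_superset_of_bounded_combinations [OF C(1), of M] by blast
  have "cball x r \<subseteq> K"
  proof
    fix y assume "y \<in> cball x r"
    then have y: "norm y \<le> norm x + r"
      using norm_triangle_sub [of y x] by (simp add: dist_norm norm_minus_commute)
    have "\<bar>y \<bullet> c / (c \<bullet> c)\<bar> \<le> M c" for c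
    proof (cases "c = 0")
      case True
      then show ?thesis by (simp add: M_def)
    next
      case False
      have "\<bar>y \<bullet> c\<bar> \<le> (norm x + r) * norm c"
        using Cauchy_Schwarz_ineq2 [of y c] mult_right_mono [OF y norm_ge_zero [of c]] by linarith
      then show ?thesis
        using False by (simp add: M_def power2_norm_eq_inner [symmetric] power2_eq_square field_simps)
    qed
    then have "(\<Sum>c\<in>C. (y \<bullet> c / (c \<bullet> c)) *\<^sub>R c) \<in> K"
      by (intro mem) simp
    then show "y \<in> K"
      using orthogonal_spanning_expansion [OF C(1,3), of y] C(2) by simp
  qed
  then show ?thesis
    using compact_Int_closed [OF K closed_cball, of x r] by (simp add: Int_absorb1)
qed

section \<open>Minty's theorem\<close>

text \<open>
  For a monotone relation \<open>P\<close>, averaging the pairs and their inner products with the same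
  weights gives \<open>A \<bullet> B \<le> t\<close>. The condition \<open>0 \<le> t + t' - A' \<bullet> B - A \<bullet> B'\<close> is affine in each
  of the triples \<open>(A, B, t)\<close> and \<open>(A', B', t')\<close> separately and is monotonicity when both are
  generators, so it passes to the hull first in one triple and then in the other. The claim is
  the case where the two triples coincide.
\<close>

lemma convex_hull_monotone_ge:
  fixes P :: "('a::real_inner \<times> 'a) set"
  assumes mono: "\<And>a b c d. (a, b) \<in> P \<Longrightarrow> (c, d) \<in> P \<Longrightarrow> 0 \<le> (a - c) \<bullet> (b - d)"
    and mem: "(A, B, t) \<in> convex hull ((\<lambda>(a, b). (a, b, a \<bullet> b)) ` P)"
  shows "A \<bullet> B \<le> t"
proof -
  let ?Q = "(\<lambda>(a, b). (a, b, a \<bullet> b)) ` P"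
  have convex_half: "convex {(A', B', t'). 0 \<le> s + t' - A' \<bullet> D - E \<bullet> B'}" for s and D E :: 'a
  proof (rule convexI)
    fix p q :: "'a \<times> 'a \<times> real" and u v :: real
    assume p: "p \<in> {(A', B', t'). 0 \<le> s + t' - A' \<bullet> D - E \<bullet> B'}"
      and q: "q \<in> {(A', B', t'). 0 \<le> s + t' - A' \<bullet> D - E \<bullet> B'}"
      and uv: "0 \<le> u" "0 \<le> v" "u + v = 1"
    obtain p1 p2 p3 q1 q2 q3 where pq: "p = (p1, p2, p3)" "q = (q1, q2, q3)"
      using prod_cases3 by metis
    have "0 \<le> u * (s + p3 - p1 \<bullet> D - E \<bullet> p2) + v * (s + q3 - q1 \<bullet> D - E \<bullet> q2)"
      using p q uv pq by simp
    also have "\<dots> = (u + v) * s + (u * p3 + v * q3) - (u *\<^sub>R p1 + v *\<^sub>R q1) \<bullet> D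
        - E \<bullet> (u *\<^sub>R p2 + v *\<^sub>R q2)"
      by (simp add: inner_add_left inner_add_right algebra_simps)
    finally show "u *\<^sub>R p + v *\<^sub>R q \<in> {(A', B', t'). 0 \<le> s + t' - A' \<bullet> D - E \<bullet> B'}"
      using uv by (simp add: pq)
  qed
  have step: "0 \<le> c \<bullet> d + t' - A' \<bullet> d - c \<bullet> B'"
    if "(c, d) \<in> P" "(A', B', t') \<in> convex hull ?Q" for c d A' B' t'
  proof -
    have "0 \<le> c \<bullet> d + a \<bullet> b - a \<bullet> d - c \<bullet> b" if ab: "(a, b) \<in> P" for a b
      using mono [OF ab \<open>(c, d) \<in> P\<close>] by (simp add: inner_diff_left inner_diff_right)
    then have "?Q \<subseteq> {(A', B', t'). 0 \<le> c \<bullet> d + t' - A' \<bullet> d - c \<bullet> B'}"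
      by auto
    then have "convex hull ?Q \<subseteq> {(A', B', t'). 0 \<le> c \<bullet> d + t' - A' \<bullet> d - c \<bullet> B'}"
      by (rule hull_minimal) (rule convex_half)
    then show ?thesis using that by auto
  qed
  have "0 \<le> t + c \<bullet> d - c \<bullet> B - A \<bullet> d" if "(c, d) \<in> P" for c d
    using step [OF that mem] by simp
  then have "?Q \<subseteq> {(A', B', t'). 0 \<le> t + t' - A' \<bullet> B - A \<bullet> B'}"
    by auto
  then have "convex hull ?Q \<subseteq> {(A', B', t'). 0 \<le> t + t' - A' \<bullet> B - A \<bullet> B'}"
    by (rule hull_minimal) (rule convex_half)
  then show ?thesis using mem by auto
qed

lemma nonneg_slope_if_min:
  fixes p q :: real
  assumes "\<And>s. 0 < s \<Longrightarrow> s \<le> 1 \<Longrightarrow> 0 \<le> p * s + q * s\<^sup>2"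
  shows "0 \<le> p"
proof (rule ccontr)
  assume "\<not> 0 \<le> p"
  define s where "s = min 1 (- p / (2 * (\<bar>q\<bar> + 1)))"
  have s: "0 < s" "s \<le> 1" "s \<le> - p / (2 * (\<bar>q\<bar> + 1))"
    using \<open>\<not> 0 \<le> p\<close> unfolding s_def
    by (simp_all only: min.cobounded1 min.cobounded2) (simp add: divide_neg_pos)
  have "s * (2 * (\<bar>q\<bar> + 1)) \<le> - p"
    using s(3) by (subst (asm) pos_le_divide_eq) simp_all
  then have "2 * s + 2 * (\<bar>q\<bar> * s) \<le> - p"
    by (simp add: algebra_simps)
  moreover have "q * s \<le> \<bar>q\<bar> * s"
    using s(1) by (simp add: mult_right_mono)
  moreover have "0 \<le> \<bar>q\<bar> * s"
    using s(1) by simp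
  ultimately have "p + q * s < 0"
    using s(1) by linarith
  then have "s * (p + q * s) < 0"
    using s(1) by (simp add: mult_pos_neg)
  then show False
    using assms [OF s(1,2)] by (simp add: power2_eq_square algebra_simps)
qed

text \<open>
  Let \<open>(A, B, t)\<close> minimise \<open>(norm (A - B))\<^sup>2 / 4 + t\<close> over the convex hull of the triples
  \<open>(a, b, a \<bullet> b)\<close>; this is the Lagrange dual of minimising the maximum of
  \<open>(x - a) \<bullet> (x + b)\<close> over \<open>P\<close>. The point \<open>x = (A - B) / 2\<close> is the required one: nonnegativity of
  the derivative in the direction of each generator bounds \<open>(x - a) \<bullet> (x + b)\<close> by
  \<open>- (norm (A - B))\<^sup>2 / 4 - t\<close>, which is at most \<open>- (norm (A + B))\<^sup>2 / 4\<close> because \<open>A \<bullet> B \<le> t\<close>.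
\<close>

lemma finite_monotone_common_point:
  fixes P :: "('a::real_inner \<times> 'a) set"
  assumes fin: "finite P"
    and mono: "\<And>a b c d. (a, b) \<in> P \<Longrightarrow> (c, d) \<in> P \<Longrightarrow> 0 \<le> (a - c) \<bullet> (b - d)"
  shows "\<exists>x. \<forall>(a, b)\<in>P. (x - a) \<bullet> (x + b) \<le> 0"
proof (cases "P = {}")
  case True
  then show ?thesis by simp
next
  case False
  define K where "K = convex hull ((\<lambda>(a, b). (a, b, a \<bullet> b)) ` P)"
  define h :: "'a \<times> 'a \<times> real \<Rightarrow> real"
    where "h p = ((fst p - fst (snd p)) \<bullet> (fst p - fst (snd p))) / 4 + snd (snd p)" for p
  have "compact K"
    unfolding K_def using fin by (intro finite_imp_compact_convex_hull) simp
  moreover have "K \<noteq> {}"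
    using False by (simp add: K_def)
  moreover have "continuous_on K h"
    unfolding h_def by (intro continuous_intros) auto
  ultimately obtain m where m: "m \<in> K" "\<And>p. p \<in> K \<Longrightarrow> h m \<le> h p"
    using continuous_attains_inf by metis
  obtain A B t where ABt: "m = (A, B, t)"
    using prod_cases3 by metis
  define x where "x = (1/2) *\<^sub>R (A - B)"
  have AB: "A \<bullet> B \<le> t"
    using convex_hull_monotone_ge [of P A B t] mono m(1) ABt unfolding K_def by blast
  have "(x - a) \<bullet> (x + b) \<le> 0" if ab: "(a, b) \<in> P" for a b
  proof -
    have in_K: "(a, b, a \<bullet> b) \<in> K"
      unfolding K_def using ab by (intro hull_inc) force
    define X where "X = A - B"
    define v where "v = (a - b) - (A - B)"
    have "0 \<le> (X \<bullet> v / 2 + (a \<bullet> b - t))"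
    proof (rule nonneg_slope_if_min)
      fix s :: real assume s: "0 < s" "s \<le> 1"
      have "(1 - s) *\<^sub>R m + s *\<^sub>R (a, b, a \<bullet> b) \<in> K"
        using s m(1) in_K convex_convex_hull [of "(\<lambda>(a, b). (a, b, a \<bullet> b)) ` P"]
        unfolding K_def by (intro convexD) auto
      moreover have "h ((1 - s) *\<^sub>R m + s *\<^sub>R (a, b, a \<bullet> b))
          = ((X + s *\<^sub>R v) \<bullet> (X + s *\<^sub>R v)) / 4 + ((1 - s) * t + s * (a \<bullet> b))"
      proof -
        have "((1 - s) *\<^sub>R A + s *\<^sub>R a) - ((1 - s) *\<^sub>R B + s *\<^sub>R b) = X + s *\<^sub>R v"
          by (simp add: X_def v_def algebra_simps)
        then show ?thesis by (simp add: h_def ABt)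
      qed
      moreover have "h m = (X \<bullet> X) / 4 + t"
        by (simp add: h_def ABt X_def)
      ultimately have "(X \<bullet> X) / 4 + t
          \<le> ((X + s *\<^sub>R v) \<bullet> (X + s *\<^sub>R v)) / 4 + ((1 - s) * t + s * (a \<bullet> b))"
        using m(2) by metis
      then show "0 \<le> (X \<bullet> v / 2 + (a \<bullet> b - t)) * s + (v \<bullet> v / 4) * s\<^sup>2"
        by (simp add: inner_add_left inner_add_right inner_commute [of v X] algebra_simps
            add_divide_distrib power2_eq_square)
    qed
    moreover have "0 \<le> (A + B) \<bullet> (A + B)"
      by simp
    ultimately show ?thesis
      using AB by (simp add: x_def X_def v_def add_divide_distrib diff_divide_distrib inner_add_left inner_add_right inner_diff_left
            inner_diff_right inner_commute algebra_simps)
  qed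
  then show ?thesis by blast
qed

lemma quadratic_le_0_iff_cball:
  fixes x a b :: "'a::real_inner"
  shows "(x - a) \<bullet> (x + b) \<le> 0 \<longleftrightarrow> x \<in> cball ((1/2) *\<^sub>R (a - b)) (norm (a + b) / 2)"
proof -
  have "x \<in> cball ((1/2) *\<^sub>R (a - b)) (norm (a + b) / 2)
      \<longleftrightarrow> norm ((1/2) *\<^sub>R (a - b) - x) \<le> norm ((1/2) *\<^sub>R (a + b))"
    by (simp add: dist_norm)
  also have "\<dots> \<longleftrightarrow> (x - a) \<bullet> (x + b) \<le> 0"
    unfolding norm_le
    by (simp add: inner_add_left inner_add_right inner_diff_left
            inner_diff_right inner_commute algebra_simps)
  finally show ?thesis by simp
qed

lemma monotone_common_point:
  fixes P :: "('a::real_inner \<times> 'a) set"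
  assumes finite_dim: "\<exists>B :: 'a set. finite B \<and> span B = UNIV"
    and mono: "\<And>a b c d. (a, b) \<in> P \<Longrightarrow> (c, d) \<in> P \<Longrightarrow> 0 \<le> (a - c) \<bullet> (b - d)"
  shows "\<exists>x. \<forall>(a, b)\<in>P. (x - a) \<bullet> (x + b) \<le> 0"
proof (cases "P = {}")
  case True
  then show ?thesis by simp
next
  case False
  then obtain p where p: "p \<in> P" by blast
  define D where "D q = cball ((1/2) *\<^sub>R (fst q - snd q)) (norm (fst q + snd q) / 2)" for q :: "'a \<times> 'a"
  have D: "x \<in> D (a, b) \<longleftrightarrow> (x - a) \<bullet> (x + b) \<le> 0" for x a b
    by (simp only: D_def quadratic_le_0_iff_cball fst_conv snd_conv)
  have "D p \<inter> (\<Inter>q\<in>P. D q) \<noteq> {}"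
  proof (rule compact_imp_fip_image)
    show "compact (D p)"
      unfolding D_def by (rule compact_cball_if_finite_span [OF finite_dim])
    show "closed (D q)" for q
      by (simp add: D_def)
    fix I assume I: "finite I" "I \<subseteq> P"
    then have "finite (insert p I)" "insert p I \<subseteq> P"
      using p by auto
    then obtain x where "\<forall>(a, b)\<in>insert p I. (x - a) \<bullet> (x + b) \<le> 0"
      using finite_monotone_common_point [of "insert p I"] mono by (metis (no_types, lifting) subsetD)
    then have "x \<in> D p \<inter> (\<Inter>q\<in>I. D q)"
      using D by fastforce
    then show "D p \<inter> (\<Inter>q\<in>I. D q) \<noteq> {}" by blast
  qed
  then show ?thesis
    using D by fastforce
qed

text \<open>
  A pair in monotone relation with the whole graph can be added to it, so by maximality it
  already belongs to it.
\<close>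

lemma maximally_monotone_memI:
  assumes max: "maximally_monotone F"
    and rel: "\<And>a b. b \<in> F a \<Longrightarrow> 0 \<le> (x - a) \<bullet> (u - b)"
  shows "u \<in> F x"
proof -
  define S where "S = F(x := insert u (F x))"
  have gph_S: "gph S = insert (x, u) (gph F)"
    by (auto simp: S_def gph_def split: if_splits)
  have "monotone_operator S"
    unfolding monotone_operator_def gph_S
  proof (intro allI impI)
    fix a b c d assume "(a, b) \<in> insert (x, u) (gph F)" "(c, d) \<in> insert (x, u) (gph F)"
    moreover have "0 \<le> (a - x) \<bullet> (b - u)" if "b \<in> F a" for a b
      using rel [OF that] by (metis inner_minus_left inner_minus_right minus_diff_eq minus_minus)
    ultimately show "0 \<le> (a - c) \<bullet> (b - d)"
      using max rel unfolding maximally_monotone_def monotone_operator_def gph_def by auto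
  qed
  then have "gph S = gph F"
    using max gph_S unfolding maximally_monotone_def by blast
  then show ?thesis
    using gph_S by (auto simp: gph_def)
qed

theorem Minty:
  fixes F :: "'a::real_inner \<Rightarrow> 'a set"
  assumes finite_dim: "\<exists>B :: 'a set. finite B \<and> span B = UNIV"
    and max: "maximally_monotone F" and gamma: "0 < \<gamma>"
  shows "\<exists>x. \<exists>u\<in>F x. y = x + \<gamma> *\<^sub>R u"
proof -
  \<comment> \<open>Scaling by \<open>\<gamma>\<close> and shifting by \<open>y\<close> preserve monotonicity and turn the inclusion
    \<open>y \<in> x + \<gamma> F x\<close> into the membership of \<open>(x, - x)\<close> in \<open>P\<close>; a common point \<open>x\<close> makes
    \<open>(x, - x)\<close> monotonically related to all of \<open>P\<close>.\<close>
  define P where "P = {(a, \<gamma> *\<^sub>R b - y) |a b. b \<in> F a}"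
  have "0 \<le> (a - c) \<bullet> (b - d)" if "(a, b) \<in> P" "(c, d) \<in> P" for a b c d
  proof -
    from that obtain b' d' where "b = \<gamma> *\<^sub>R b' - y" "b' \<in> F a" "d = \<gamma> *\<^sub>R d' - y" "d' \<in> F c"
      by (auto simp: P_def)
    moreover from this have "0 \<le> (a - c) \<bullet> (b' - d')"
      using max unfolding maximally_monotone_def monotone_operator_def gph_def by auto
    ultimately show ?thesis
      using gamma by (simp add: scaleR_diff_right [symmetric])
  qed
  then obtain x where x: "\<forall>(a, b)\<in>P. (x - a) \<bullet> (x + b) \<le> 0"
    using monotone_common_point [OF finite_dim] by metis
  define u where "u = (1/\<gamma>) *\<^sub>R (y - x)"
  have "u \<in> F x"
  proof (rule maximally_monotone_memI [OF max])
    fix a b assume "b \<in> F a"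
    then have "(x - a) \<bullet> (x + (\<gamma> *\<^sub>R b - y)) \<le> 0"
      using x by (force simp: P_def)
    moreover have "x + (\<gamma> *\<^sub>R b - y) = - \<gamma> *\<^sub>R (u - b)"
      using gamma by (simp add: u_def algebra_simps)
    ultimately show "0 \<le> (x - a) \<bullet> (u - b)"
      using gamma by (simp add: zero_le_mult_iff)
  qed
  moreover have "y = x + \<gamma> *\<^sub>R u"
    using gamma by (simp add: u_def)
  ultimately show ?thesis by blast
qed

section \<open>The resolvent\<close>

text \<open>
  Since the resolvent has exactly one value \<open>x\<close> at \<open>y\<close>, \<open>the_elem\<close> selects it, and the defining
  inclusion \<open>y \<in> x + \<gamma> F x\<close> is available for it.
\<close>

lemma resolvent_map_works:
  fixes F :: "'a::real_inner \<Rightarrow> 'a set"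
  assumes finite_dim: "\<exists>B :: 'a set. finite B \<and> span B = UNIV"
    and max: "maximally_monotone F" and gamma: "0 < \<gamma>"
  shows "(1/\<gamma>) *\<^sub>R (y - resolvent_map \<gamma> F y) \<in> F (resolvent_map \<gamma> F y)"
proof -
  obtain x u where xu: "u \<in> F x" "y = x + \<gamma> *\<^sub>R u"
    using Minty [OF assms] by blast
  have "x' = x" if x': "x' \<in> resolvent \<gamma> F y" for x'
  proof -
    obtain u' where u': "u' \<in> F x'" "y = x' + \<gamma> *\<^sub>R u'"
      using x' by (auto simp: resolvent_def op_inverse_def)
    have "0 \<le> (x' - x) \<bullet> (u' - u)"
      using max u'(1) xu(1) unfolding maximally_monotone_def monotone_operator_def gph_def by auto
    moreover have "x' - x = - \<gamma> *\<^sub>R (u' - u)"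
      using u'(2) xu(2) by (simp add: algebra_simps)
    ultimately have "(u' - u) \<bullet> (u' - u) \<le> 0"
      using gamma by (simp add: mult_le_0_iff)
    then have "u' = u"
      by (metis inner_ge_zero inner_eq_zero_iff order_antisym right_minus_eq)
    then show ?thesis using u'(2) xu(2) by simp
  qed
  moreover have "x \<in> resolvent \<gamma> F y"
    using xu by (auto simp: resolvent_def op_inverse_def)
  ultimately have "resolvent \<gamma> F y = {x}" by blast
  then have "resolvent_map \<gamma> F y = x"
    by (simp add: resolvent_map_def)
  then show ?thesis
    using xu gamma by simp
qed

lemma firmly_nonexpansive_resolvent:
  fixes F :: "'a::real_inner \<Rightarrow> 'a set"
  assumes "\<exists>B :: 'a set. finite B \<and> span B = UNIV"
    and max: "maximally_monotone F" and gamma: "0 < \<gamma>"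
  defines "J \<equiv> resolvent_map \<gamma> F"
  shows "(norm (J x - J y))\<^sup>2 \<le> (J x - J y) \<bullet> (x - y)"
proof -
  have "0 \<le> (J x - J y) \<bullet> ((1/\<gamma>) *\<^sub>R (x - J x) - (1/\<gamma>) *\<^sub>R (y - J y))"
    using max resolvent_map_works [OF assms(1-3)]
    unfolding J_def maximally_monotone_def monotone_operator_def gph_def by auto
  also have "\<dots> = (1/\<gamma>) * ((J x - J y) \<bullet> ((x - y) - (J x - J y)))"
    by (simp add: algebra_simps flip: inner_scaleR_right)
  finally have "0 \<le> (J x - J y) \<bullet> ((x - y) - (J x - J y))"
    using gamma by (simp add: zero_le_divide_iff)
  then show ?thesis
    by (simp add: power2_norm_eq_inner inner_diff_right)
qed

lemma nonexpansive_resolvent: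
  fixes F :: "'a::real_inner \<Rightarrow> 'a set"
  assumes "\<exists>B :: 'a set. finite B \<and> span B = UNIV"
    and "maximally_monotone F" and "0 < \<gamma>"
  shows "norm (resolvent_map \<gamma> F x - resolvent_map \<gamma> F y) \<le> norm (x - y)"
proof -
  let ?d = "resolvent_map \<gamma> F x - resolvent_map \<gamma> F y"
  have "norm ?d * norm ?d \<le> norm ?d * norm (x - y)"
    using firmly_nonexpansive_resolvent [OF assms, of x y] norm_cauchy_schwarz [of ?d "x - y"]
    by (simp add: power2_eq_square)
  then show ?thesis
    by (cases "?d = 0") auto
qed

lemma resolvent_fixed_iff_zero:
  fixes F :: "'a::real_inner \<Rightarrow> 'a set"
  assumes "\<exists>B :: 'a set. finite B \<and> span B = UNIV"
    and max: "maximally_monotone F" and gamma: "0 < \<gamma>"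
  shows "resolvent_map \<gamma> F w = w \<longleftrightarrow> w \<in> op_inverse F 0"
proof
  assume "resolvent_map \<gamma> F w = w"
  then show "w \<in> op_inverse F 0"
    using resolvent_map_works [OF assms, of w] by (simp add: op_inverse_def)
next
  assume "w \<in> op_inverse F 0"
  let ?d = "resolvent_map \<gamma> F w - w"
  have "0 \<le> ?d \<bullet> ((1/\<gamma>) *\<^sub>R (w - resolvent_map \<gamma> F w) - 0)"
    using max resolvent_map_works [OF assms, of w] \<open>w \<in> op_inverse F 0\<close>
    unfolding maximally_monotone_def monotone_operator_def gph_def op_inverse_def by blast
  also have "\<dots> = - (?d \<bullet> ?d) / \<gamma>"
    by (simp add: inner_diff_right inner_diff_left)
  finally have "?d \<bullet> ?d \<le> 0"
    using gamma by (simp add: divide_le_0_iff)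
  then show "resolvent_map \<gamma> F w = w"
    by (metis inner_ge_zero inner_eq_zero_iff order_antisym right_minus_eq)
qed

lemma relaxed_resolvent_step:
  fixes F :: "'a::real_inner \<Rightarrow> 'a set"
  assumes fd: "\<exists>B :: 'a set. finite B \<and> span B = UNIV"
    and max: "maximally_monotone F" and gamma: "0 < \<gamma>"
    and w: "w \<in> op_inverse F 0" and "0 \<le> l"
  defines "J \<equiv> resolvent_map \<gamma> F"
  shows "(norm (y + l *\<^sub>R (J y - y) - w))\<^sup>2 \<le> (norm (y - w))\<^sup>2 - l * (2 - l) * (norm (J y - y))\<^sup>2"
proof -
  have "J w = w"
    using resolvent_fixed_iff_zero [OF fd max gamma] w by (simp add: J_def)
  then have "(norm (J y - w))\<^sup>2 \<le> (J y - w) \<bullet> (y - w)"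
    using firmly_nonexpansive_resolvent [OF fd max gamma, of y w] by (simp add: J_def)
  then have "(J y - y) \<bullet> (y - w) \<le> - (norm (J y - y))\<^sup>2"
    by (simp add: power2_norm_eq_inner inner_diff_left inner_diff_right inner_commute)
  from mult_left_mono [OF this, of "2 * l"] \<open>0 \<le> l\<close>
  have "2 * l * ((J y - y) \<bullet> (y - w)) \<le> - 2 * l * (norm (J y - y))\<^sup>2" by simp
  moreover have "(norm (y + l *\<^sub>R (J y - y) - w))\<^sup>2
      = (norm (y - w))\<^sup>2 + 2 * l * ((J y - y) \<bullet> (y - w)) + l\<^sup>2 * (norm (J y - y))\<^sup>2"
  proof -
    have "y + l *\<^sub>R (J y - y) - w = (y - w) + l *\<^sub>R (J y - y)" by simp
    then show ?thesis
      by (simp only: power2_norm_eq_inner)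
        (simp add: inner_add_left inner_add_right inner_commute power2_eq_square)
  qed
  ultimately show ?thesis
    by (simp add: algebra_simps power2_eq_square)
qed

section \<open>Convergence and rate of the proximal point iteration\<close>

lemma dist_set_eq_infdist:
  assumes "S \<noteq> {}"
  shows "dist_set x S = ereal (infdist x S)"
proof -
  have "ereal (INF s\<in>S. dist x s) = (INF s\<in>S. ereal (dist x s))"
    using assms by (subst ereal_Inf') (auto simp: image_comp)
  then show ?thesis
    using assms by (simp add: dist_set_def infdist_notempty dist_norm)
qed

lemma subregular_infdist_le:
  assumes "dist_set x S \<le> ereal \<kappa> * dist_set 0 T" "0 < \<kappa>" "S \<noteq> {}" "u \<in> T"
  shows "infdist x S \<le> \<kappa> * norm u"
proof -
  have "dist_set 0 T \<le> ereal (norm u)"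
    unfolding dist_set_def using assms(4) by (rule INF_lower2) simp
  then have "ereal \<kappa> * dist_set 0 T \<le> ereal \<kappa> * ereal (norm u)"
    using assms(2) by (intro ereal_mult_left_mono) auto
  with assms(1) have "dist_set x S \<le> ereal (\<kappa> * norm u)"
    by (metis order_trans times_ereal.simps(1))
  then have "ereal (infdist x S) \<le> ereal (\<kappa> * norm u)"
    by (simp only: dist_set_eq_infdist [OF assms(3)])
  then show ?thesis by simp
qed

text \<open>
  Passing to the infimum over \<open>w\<close> in this form avoids projecting \<open>x\<close> onto \<open>S\<close>, so neither
  closedness nor convexity of \<open>S\<close> is needed.
\<close>

lemma infdist_power2_le:
  assumes "S \<noteq> {}" and "\<And>w. w \<in> S \<Longrightarrow> (infdist y S)\<^sup>2 + c \<le> (dist x w)\<^sup>2" and "0 \<le> c"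
  shows "(infdist y S)\<^sup>2 + c \<le> (infdist x S)\<^sup>2"
proof -
  have "sqrt ((infdist y S)\<^sup>2 + c) \<le> infdist x S"
    unfolding infdist_notempty [OF assms(1), of x]
  proof (rule cINF_greatest [OF assms(1)])
    fix w assume "w \<in> S"
    from real_sqrt_le_mono [OF assms(2) [OF this]]
    show "sqrt ((infdist y S)\<^sup>2 + c) \<le> dist x w" by simp
  qed
  from power_mono [OF this, of 2] assms(3) show ?thesis by simp
qed

theorem theorem3p1:
  fixes F :: "'a::real_inner \<Rightarrow> 'a set"
    and \<gamma> :: real
    and lam :: "nat \<Rightarrow> real"
    and z :: "nat \<Rightarrow> 'a"
  assumes finite_dim: "\<exists>B :: 'a set. finite B \<and> span B = UNIV"
    and max_mono: "maximally_monotone F"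
    and zeros: "op_inverse F 0 \<noteq> {}"
    and gamma: "\<gamma> > 0"
    and lam_range: "\<And>k. lam k \<in> {0..2}"
    and lam_sum: "filterlim (\<lambda>n. \<Sum>k<n. lam k * (2 - lam k)) at_top sequentially"
    and gppa: "\<And>k. z (Suc k) = z k + lam k *\<^sub>R (resolvent_map \<gamma> F (z k) - z k)"
  shows "\<exists>zs \<in> op_inverse F 0.
      z \<longlonglongrightarrow> zs \<and>
      (\<forall>w \<in> op_inverse F 0. \<forall>k.
         (norm (z (Suc k) - w))\<^sup>2
           \<le> (norm (z k - w))\<^sup>2 - lam k * (2 - lam k) * (norm (resolvent_map \<gamma> F (z k) - z k))\<^sup>2) \<and>
      (\<forall>\<kappa>. metrically_subregular F zs 0 \<kappa> \<longrightarrow>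
         (\<exists>kb. \<forall>k\<ge>kb.
            dist_set (z (Suc k)) (op_inverse F 0)
              \<le> ereal (sqrt (1 - lam k * (2 - lam k) * \<gamma>\<^sup>2 / (\<gamma> + \<kappa>)\<^sup>2))
                 * dist_set (z k) (op_inverse F 0)))"
proof -
  define J where "J = resolvent_map \<gamma> F"
  define S where "S = op_inverse F 0"
  define a where "a k = lam k * (2 - lam k)" for k
  have a: "0 \<le> a k" for k
    using lam_range [of k] by (simp add: a_def)
  have fejer: "(norm (z (Suc k) - w))\<^sup>2 \<le> (norm (z k - w))\<^sup>2 - a k * (norm (J (z k) - z k))\<^sup>2"
    if "w \<in> S" for w k
    using relaxed_resolvent_step [OF finite_dim max_mono gamma, of w "lam k" "z k"] that lam_range [of k]
    by (simp add: gppa a_def J_def S_def)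
  have decr: "norm (z n - w) \<le> norm (z m - w)" if "w \<in> S" "m \<le> n" for w m n
    using that(2)
  proof (induction n rule: dec_induct)
    case (step n)
    have "(norm (z (Suc n) - w))\<^sup>2 \<le> (norm (z n - w))\<^sup>2"
      using fejer [OF that(1), of n] a [of n]
      by (smt (verit) mult_nonneg_nonneg zero_le_power2)
    then have "norm (z (Suc n) - w) \<le> norm (z n - w)"
      by (rule power2_le_imp_le) simp
    then show ?case using step by linarith
  qed simp
  obtain w0 where w0: "w0 \<in> S"
    using zeros by (auto simp: S_def)

  have small: "\<exists>k. norm (J (z k) - z k) < e" if "0 < e" for e
  proof (rule ccontr)
    assume "\<not> ?thesis"
    then have ge: "e \<le> norm (J (z k) - z k)" for k
      by (simp add: not_less)
    have "e\<^sup>2 * (\<Sum>k<n. a k) \<le> (norm (z 0 - w0))\<^sup>2 - (norm (z n - w0))\<^sup>2" for n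
    proof (induction n)
      case (Suc n)
      have "a n * e\<^sup>2 \<le> a n * (norm (J (z n) - z n))\<^sup>2"
        using ge [of n] \<open>0 < e\<close> a by (intro mult_left_mono power_mono) auto
      with Suc fejer [OF w0, of n] show ?case
        by (simp add: algebra_simps)
    qed simp
    then have "e\<^sup>2 * (\<Sum>k<n. a k) \<le> (norm (z 0 - w0))\<^sup>2" for n
      by (smt (verit) zero_le_power2)
    then have bound: "(\<Sum>k<n. a k) \<le> (norm (z 0 - w0))\<^sup>2 / e\<^sup>2" for n
      using \<open>0 < e\<close> by (simp add: field_simps)
    have "eventually (\<lambda>n. (norm (z 0 - w0))\<^sup>2 / e\<^sup>2 < (\<Sum>k<n. a k)) sequentially"
      using lam_sum unfolding a_def filterlim_at_top_dense by blast
    then show False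
      using bound by (auto simp: eventually_sequentially not_less [symmetric])
  qed
  \<comment> \<open>The indices \<open>idx n\<close> need not increase: convergence of these points to a zero already forces
    convergence of the whole sequence, its distance to that zero being nonincreasing.\<close>
  define idx where "idx n = (SOME k. norm (J (z k) - z k) < inverse (real (Suc n)))" for n
  have idx: "norm (J (z (idx n)) - z (idx n)) < inverse (real (Suc n))" for n
    unfolding idx_def by (rule someI_ex) (rule small, simp)
  have "\<forall>n. z (idx n) \<in> cball w0 (norm (z 0 - w0))"
    using decr [OF w0] by (simp add: dist_norm norm_minus_commute)
  then obtain zs r where r: "strict_mono r" and lim: "((\<lambda>n. z (idx n)) \<circ> r) \<longlonglongrightarrow> zs"
    using compact_cball_if_finite_span [OF finite_dim, of w0 "norm (z 0 - w0)"]
    unfolding compact_def by metis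
  have resid: "(\<lambda>n. J (z (idx (r n))) - z (idx (r n))) \<longlonglongrightarrow> 0"
  proof (rule Lim_null_comparison)
    show "\<forall>\<^sub>F n in sequentially. norm (J (z (idx (r n))) - z (idx (r n))) \<le> inverse (real (Suc (r n)))"
      using idx by (intro always_eventually allI less_imp_le)
    show "(\<lambda>n. inverse (real (Suc (r n)))) \<longlonglongrightarrow> 0"
      using LIMSEQ_subseq_LIMSEQ [OF LIMSEQ_inverse_real_of_nat r] by (simp add: o_def)
  qed
  have J_tendsto: "(\<lambda>n. J (y n)) \<longlonglongrightarrow> J l" if "y \<longlonglongrightarrow> l" for y l
  proof (rule LIM_zero_cancel, rule Lim_null_comparison)
    show "\<forall>\<^sub>F n in sequentially. norm (J (y n) - J l) \<le> norm (y n - l)"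
      using nonexpansive_resolvent [OF finite_dim max_mono gamma] by (simp add: J_def)
    show "(\<lambda>n. norm (y n - l)) \<longlonglongrightarrow> 0"
      using that by (simp add: LIM_zero tendsto_norm_zero)
  qed
  have "(\<lambda>n. J (z (idx (r n))) - z (idx (r n))) \<longlonglongrightarrow> J zs - zs"
    using lim by (intro tendsto_diff J_tendsto) (simp_all add: o_def)
  then have "J zs = zs"
    using LIMSEQ_unique [OF resid] by force
  then have zs: "zs \<in> S"
    using resolvent_fixed_iff_zero [OF finite_dim max_mono gamma] by (simp add: J_def S_def)
  have z_lim: "z \<longlonglongrightarrow> zs"
  proof (rule LIMSEQ_I)
    fix e :: real assume "0 < e"
    from LIMSEQ_D [OF lim this] obtain n where "norm (z (idx (r n)) - zs) < e"
      by (auto simp: o_def)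
    then show "\<exists>no. \<forall>n\<ge>no. norm (z n - zs) < e"
      using decr [OF zs] by (meson le_less_trans)
  qed

  have rate: "\<exists>kb. \<forall>k\<ge>kb. dist_set (z (Suc k)) S
      \<le> ereal (sqrt (1 - lam k * (2 - lam k) * \<gamma>\<^sup>2 / (\<gamma> + \<kappa>)\<^sup>2)) * dist_set (z k) S"
    if sub: "metrically_subregular F zs 0 \<kappa>" for \<kappa>
  proof -
    obtain U where "0 < \<kappa>" and U: "open U" "zs \<in> U"
      and dU: "\<And>x. x \<in> U \<Longrightarrow> dist_set x S \<le> ereal \<kappa> * dist_set 0 (F x)"
      using sub unfolding metrically_subregular_def S_def by blast
    have "\<forall>\<^sub>F k in sequentially. J (z k) \<in> U"
      using topological_tendstoD [OF J_tendsto [OF z_lim] U(1)] U(2) \<open>J zs = zs\<close> by simp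
    then obtain kb where kb: "\<And>k. kb \<le> k \<Longrightarrow> J (z k) \<in> U"
      by (auto simp: eventually_sequentially)
    have "dist_set (z (Suc k)) S
      \<le> ereal (sqrt (1 - lam k * (2 - lam k) * \<gamma>\<^sup>2 / (\<gamma> + \<kappa>)\<^sup>2)) * dist_set (z k) S"
      if "kb \<le> k" for k
    proof -
      define d where "d = norm (J (z k) - z k)"
      have S_ne: "S \<noteq> {}" using w0 by blast
      have "infdist (J (z k)) S \<le> \<kappa> * norm ((1/\<gamma>) *\<^sub>R (z k - J (z k)))"
        using resolvent_map_works [OF finite_dim max_mono gamma, of "z k"]
        by (intro subregular_infdist_le [OF dU [OF kb [OF that]] \<open>0 < \<kappa>\<close> S_ne]) (simp add: J_def)
      also have "\<dots> = \<kappa> * d / \<gamma>"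
        using gamma by (simp add: d_def norm_minus_commute)
      finally have "infdist (z k) S \<le> d + \<kappa> * d / \<gamma>"
        using infdist_triangle [of "z k" S "J (z k)"] by (simp add: d_def dist_norm norm_minus_commute)
      then have "infdist (z k) S \<le> (\<gamma> + \<kappa>) * d / \<gamma>"
        using gamma by (simp add: field_simps)
      then have "\<gamma> / (\<gamma> + \<kappa>) * infdist (z k) S \<le> d"
        using gamma \<open>0 < \<kappa>\<close> by (simp add: field_simps)
      then have "(\<gamma> / (\<gamma> + \<kappa>) * infdist (z k) S)\<^sup>2 \<le> d\<^sup>2"
        using gamma \<open>0 < \<kappa>\<close> by (intro power_mono) (auto simp: infdist_nonneg)
      then have d_ge: "a k * (\<gamma> / (\<gamma> + \<kappa>) * infdist (z k) S)\<^sup>2 \<le> a k * d\<^sup>2"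
        using a by (intro mult_left_mono)
      have "(infdist (z (Suc k)) S)\<^sup>2 + a k * d\<^sup>2 \<le> (infdist (z k) S)\<^sup>2"
      proof (rule infdist_power2_le [OF S_ne])
        fix w assume w: "w \<in> S"
        have "(infdist (z (Suc k)) S)\<^sup>2 \<le> (dist (z (Suc k)) w)\<^sup>2"
          using w by (intro power_mono infdist_le infdist_nonneg)
        then show "(infdist (z (Suc k)) S)\<^sup>2 + a k * d\<^sup>2 \<le> (dist (z k) w)\<^sup>2"
          using fejer [OF w, of k] by (simp add: dist_norm d_def)
      qed (use a in simp)
      with d_ge have "(infdist (z (Suc k)) S)\<^sup>2
          \<le> (1 - a k * \<gamma>\<^sup>2 / (\<gamma> + \<kappa>)\<^sup>2) * (infdist (z k) S)\<^sup>2"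
        by (simp add: algebra_simps power_mult_distrib power_divide)
      from real_sqrt_le_mono [OF this]
      have "infdist (z (Suc k)) S \<le> sqrt (1 - a k * \<gamma>\<^sup>2 / (\<gamma> + \<kappa>)\<^sup>2) * infdist (z k) S"
        by (simp add: real_sqrt_mult infdist_nonneg)
      then show ?thesis
        by (simp add: dist_set_eq_infdist [OF S_ne] a_def)
    qed
    then show ?thesis by blast
  qed
  show ?thesis
    using zs z_lim fejer rate unfolding S_def J_def a_def by blast
qed

end
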